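(* Let $A$, $\sigma$, $B=(A-\sigma I)^{-1}$, $(\lambda,x)$, $L$, $\mathrm{sep}(\cdot,L)$, $\mathcal{V}$, $(\nu,y)$, $\alpha_1,\alpha_2$, $u$, $\tilde u$, $\varepsilon$, $f$ and $\tilde\varepsilon$ be as in the context, and let $\alpha=-\frac{\alpha_2}{\alpha_1}$. Assume that $\alpha$ is an approximation to $\frac{1}{\lambda-\sigma}$ and is not an eigenvalue of $L$. Then $$\varepsilon\le\frac{2\|B\|}{\mathrm{sep}(\alpha,L)\,\sin\angle(\mathcal{V},f)}\,\tilde\varepsilon .$$ In particular, for $\alpha=\frac{1}{\nu-\sigma}$ and $\alpha=y^HBy$, which correspond to the SIRA and JD methods respectively, assume that each of them is not an eigenvalue of $L$. Then, denoting $\varepsilon$ by $\varepsilon_S$ and $\varepsilon_J$ in the SIRA and JD methods respectively, $$\varepsilon_S\le\frac{2\|B\|}{\mathrm{sep}\left(\frac{1}{\nu-\sigma},L\right)\sin\angle(\mathcal{V},f)}\,\tilde\varepsilon$$ and $$\varepsilon_J\le\frac{2\|B\|}{\mathrm{sep}\left(y^HBy,L\right)\sin\angle(\mathcal{V},f)}\,\tilde\varepsilon ,$$ where in each bound $f$ and $\tilde\varepsilon$ are those of the respective method.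
   Context: $\|\cdot\|$ is the 2-norm, $H$ denotes conjugate transpose. For a nonzero vector $w$ and a subspace $\mathcal{W}$ of $\mathbb{C}^n$ with orthogonal projector $P_{\mathcal{W}}$, $\sin\angle(\mathcal{W},w)=\|(I-P_{\mathcal{W}})w\|/\|w\|$. $A\in\mathbb{C}^{n\times n}$ has eigenvalues labeled so that $0<|\lambda_1-\sigma|<|\lambda_2-\sigma|\le\cdots\le|\lambda_n-\sigma|$ for a given target $\sigma\in\mathbb{C}$; $(\lambda,x)=(\lambda_1,x_1)$ is the desired (simple) eigenpair, $\|x\|=1$, and $B=(A-\sigma I)^{-1}$, so $(\frac1{\lambda-\sigma},x)$ is a simple eigenpair of $B$. Let $X_\perp$ be such that $(x,X_\perp)$ is unitary, and set $L=X_\perp^HBX_\perp$. For $\alpha\in\mathbb{C}$ not an eigenvalue of $L$, $\mathrm{sep}(\alpha,L)=\|(L-\alpha I)^{-1}\|^{-1}>0$. $\mathcal{V}$ is the current subspace, $V$ a matrix whose columns form an orthonormal basis of it, and $P_V$ the orthogonal projector onto $\mathcal{V}$. The current approximate eigenpair is $(\nu,y)$ with $y=Vz$, where $(\nu,z)$ is an eigenpair of $V^HAV$ and $\|z\|=1$; so $y\in\mathcal{V}$ and $\|y\|=1$. For $\alpha_1,\alpha_2\in\mathbb{C}$ with $\alpha_1\ne0$, consider the inner linear system $$(A-\sigma I)u=\alpha_1y+\alpha_2(A-\sigma I)y,$$ with exact solution $u=\alpha_1By+\alpha_2y$. The SIRA method uses $\alpha_1=\sigma-\nu$, $\alpha_2=1$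 (with $\nu\neq\sigma$), i.e. $(A-\sigma I)u=Ay-\nu y$; the JD method with fixed target $\sigma$ uses $\alpha_1=-\frac{1}{y^HBy}$, $\alpha_2=1$ (with $y^HBy\ne0$). Let $\tilde u$ be an approximate solution with relative error $\varepsilon=\|\tilde u-u\|/\|u\|$, and write $\tilde u=u+\varepsilon\|u\|f$ with $\|f\|=1$. Define $$\tilde\varepsilon=\frac{\|(I-P_V)\tilde u-(I-P_V)u\|}{\|(I-P_V)u\|}.$$ All quantities appearing are assumed well defined: $u\neq0$, $(I-P_V)u\neq0$, and $f\notin\mathcal{V}$ (so $\sin\angle(\mathcal{V},f)\ne0$). The phrase "$\alpha$ is an approximation to $\frac1{\lambda-\sigma}$" is descriptive and carries no quantitative condition. *)

theory Defs
  imports "HOL-Analysis.Analysis"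
begin

definition ctrans :: "complex^'m^'n \<Rightarrow> complex^'n^'m" where
  "ctrans M = (\<chi> i j. cnj (M $ j $ i))"

text \<open>The scalar \<open>v\<^sup>H w\<close>, conjugate-linear in the first argument.\<close>

definition cinner :: "complex^'n \<Rightarrow> complex^'n \<Rightarrow> complex" where
  "cinner v w = (\<Sum>i\<in>UNIV. cnj (v $ i) * w $ i)"

text \<open>The row and column index types may differ, since block matrices come with a column index
  type of their own; the two equations force both types to have the same cardinality.\<close>

definition unitary :: "complex^'k^'n \<Rightarrow> bool" where
  "unitary Q \<longleftrightarrow> ctrans Q ** Q = mat 1 \<and> Q ** ctrans Q = mat 1"

text \<open>The block matrix \<open>(x, X)\<close>: column \<open>None\<close> is \<open>x\<close>, column \<open>Some k\<close> is column \<open>k\<close> of \<open>X\<close>.\<close>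

definition cons_column :: "complex^'n \<Rightarrow> complex^'m^'n \<Rightarrow> complex^('m option)^'n" where
  "cons_column x X = (\<chi> i j. case j of None \<Rightarrow> x $ i | Some k \<Rightarrow> X $ i $ k)"

definition eigenpair :: "complex^'n^'n \<Rightarrow> complex \<Rightarrow> complex^'n \<Rightarrow> bool" where
  "eigenpair M \<mu> v \<longleftrightarrow> v \<noteq> 0 \<and> M *v v = \<mu> *s v"

definition eigenvalue :: "complex^'n^'n \<Rightarrow> complex \<Rightarrow> bool" where
  "eigenvalue M \<mu> \<longleftrightarrow> (\<exists>v. eigenpair M \<mu> v)"

text \<open>\<open>lam 1, \<dots>, lam n\<close> are the eigenvalues of an \<open>n \<times> n\<close> matrix counted with algebraic
  multiplicity, i.e. the roots of its characteristic polynomial. Other values of \<open>lam\<close> are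
  irrelevant.\<close>

definition eigenvalue_labelling :: "complex^'n^'n \<Rightarrow> (nat \<Rightarrow> complex) \<Rightarrow> bool" where
  "eigenvalue_labelling M lam \<longleftrightarrow>
     (\<forall>t. det (mat t - M) = (\<Prod>i = 1..CARD('n). t - lam i))"

text \<open>The vector norm on \<^typ>\<open>complex^'n\<close> is the 2-norm, so \<^const>\<open>onorm\<close> gives the spectral norm.\<close>

definition matnorm :: "complex^'m^'n \<Rightarrow> real" where
  "matnorm M = onorm ((*v) M)"

text \<open>Only meaningful when \<open>\<alpha>\<close> is not an eigenvalue of \<open>L\<close>.\<close>

definition sep :: "complex \<Rightarrow> complex^'m^'m \<Rightarrow> real" where
  "sep \<alpha> L = inverse (matnorm (matrix_inv (L - mat \<alpha>)))"

definition orthonormal_basis_cols :: "complex^'k^'n \<Rightarrow> (complex^'n) set \<Rightarrow> bool" where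
  "orthonormal_basis_cols V W \<longleftrightarrow> ctrans V ** V = mat 1 \<and> vec.span (columns V) = W"

text \<open>Only meaningful when \<open>W\<close> is a complex subspace.\<close>

definition orth_projector :: "(complex^'n) set \<Rightarrow> complex^'n^'n" where
  "orth_projector W = (THE P. P ** P = P \<and> ctrans P = P \<and> range ((*v) P) = W)"

definition sin_angle :: "(complex^'n) set \<Rightarrow> complex^'n \<Rightarrow> real" where
  "sin_angle W w = norm ((mat 1 - orth_projector W) *v w) / norm w"

definition rel_error :: "complex^'n \<Rightarrow> complex^'n \<Rightarrow> real" where
  "rel_error u ut = norm (ut - u) / norm u"

definition proj_rel_error :: "(complex^'n) set \<Rightarrow> complex^'n \<Rightarrow> complex^'n \<Rightarrow> real" where
  "proj_rel_error W u ut =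
     (let Q = mat 1 - orth_projector W in norm (Q *v ut - Q *v u) / norm (Q *v u))"

text \<open>\<open>u\<close> is the exact solution of the inner linear system for the parameters \<open>\<alpha>\<^sub>1\<close>, \<open>\<alpha>\<^sub>2\<close>, \<open>ut\<close> is an
  approximate solution and \<open>f\<close> is the normalized direction of its error, with all error quantities
  well defined.\<close>

definition inner_solve ::
  "complex^'n^'n \<Rightarrow> complex \<Rightarrow> (complex^'n) set \<Rightarrow> complex^'n \<Rightarrow> complex \<Rightarrow> complex \<Rightarrow>
   complex^'n \<Rightarrow> complex^'n \<Rightarrow> complex^'n \<Rightarrow> bool" where
  "inner_solve A \<sigma> W y \<alpha>\<^sub>1 \<alpha>\<^sub>2 u ut f \<longleftrightarrow>
     (A - mat \<sigma>) *v u = \<alpha>\<^sub>1 *s y + \<alpha>\<^sub>2 *s ((A - mat \<sigma>) *v y) \<and>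
     u \<noteq> 0 \<and> (mat 1 - orth_projector W) *v u \<noteq> 0 \<and>
     ut = u + (rel_error u ut * norm u) *\<^sub>R f \<and> norm f = 1 \<and> f \<notin> W"

lemma range_matrix_vector_mult: "range ((*v) M) = vec.span (columns M)"
  for M :: "complex^'m^'n"
proof
  show "range ((*v) M) \<subseteq> vec.span (columns M)"
    using matrix_vector_mult_in_columnspace_gen by blast
next
  have "column i M = M *v axis i 1" for i
    by (simp add: vec_eq_iff column_def matrix_vector_mult_def axis_def if_distrib[of "(*) _"] cong: if_cong)
  then have "column i M \<in> range ((*v) M)" for i
    by (metis rangeI)
  then have "columns M \<subseteq> range ((*v) M)"
    by (auto simp: columns_def)
  moreover have "vec.subspace (range ((*v) M))"
    using matrix_vector_mul_linear_gen vec.subspace_UNIV vec.subspace_image by blast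
  ultimately show "vec.span (columns M) \<subseteq> range ((*v) M)"
    by (simp add: vec.span_minimal)
qed

lemma ctrans_ctrans [simp]: "ctrans (ctrans M) = M"
  by (simp add: ctrans_def vec_eq_iff)

lemma ctrans_mult: "ctrans (M ** N) = ctrans N ** ctrans M"
  by (simp add: ctrans_def matrix_matrix_mult_def vec_eq_iff mult.commute)

lemma orth_projector_eq:
  fixes V :: "complex^'k^'n"
  assumes "orthonormal_basis_cols V W"
  shows "orth_projector W = V ** ctrans V"
  unfolding orth_projector_def
proof (rule the_equality)
  have VV: "ctrans V ** V = mat 1" and W: "W = range ((*v) V)"
    using assms by (auto simp: orthonormal_basis_cols_def range_matrix_vector_mult)
  let ?Q = "V ** ctrans V"
  have QV: "?Q ** V = V"
    by (metis VV matrix_mul_assoc matrix_mul_rid)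
  have Qsym: "ctrans ?Q = ?Q"
    by (simp add: ctrans_mult)
  have Qran: "range ((*v) ?Q) = W"
  proof
    show "range ((*v) ?Q) \<subseteq> W"
      unfolding W by (auto simp flip: matrix_vector_mul_assoc)
    show "W \<subseteq> range ((*v) ?Q)"
      unfolding W by (metis QV image_subsetI matrix_vector_mul_assoc rangeI)
  qed
  show "?Q ** ?Q = ?Q \<and> ctrans ?Q = ?Q \<and> range ((*v) ?Q) = W"
    using QV Qsym Qran by (metis matrix_mul_assoc)
  fix P assume P: "P ** P = P \<and> ctrans P = P \<and> range ((*v) P) = W"
  have "P *v (?Q *v v) = ?Q *v v" for v
  proof -
    have "?Q *v v \<in> range ((*v) P)" using P Qran by blast
    then show ?thesis using P by (metis imageE matrix_vector_mul_assoc)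
  qed
  then have PQ: "P ** ?Q = ?Q"
    by (simp add: matrix_eq flip: matrix_vector_mul_assoc)
  have "?Q *v (P *v v) = P *v v" for v
  proof -
    have "P *v v \<in> range ((*v) V)" using P W by blast
    then show ?thesis using QV by (metis imageE matrix_vector_mul_assoc)
  qed
  then have "?Q ** P = P"
    by (simp add: matrix_eq flip: matrix_vector_mul_assoc)
  then show "P = ?Q"
    using PQ P Qsym by (metis ctrans_mult)
qed

end

theory Submission
  imports Defs
begin

text \<open>
  Write \<open>P\<close> for the orthogonal projector onto \<open>W\<close>. The error vector \<open>ut - u\<close> has length
  \<open>\<epsilon> \<parallel>u\<parallel>\<close> and direction \<open>f\<close>, so its part outside \<open>W\<close> has length \<open>\<epsilon> \<parallel>u\<parallel> sin \<angle>(W, f)\<close>. Hence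
  \<open>\<epsilon>\<close> equals the relative error outside \<open>W\<close>, divided by \<open>sin \<angle>(W, f)\<close> and multiplied by
  \<open>\<parallel>(I - P) u\<parallel> / \<parallel>u\<parallel>\<close>. The point is that this last ratio is at most \<open>2 \<parallel>B\<parallel> / sep(\<alpha>, L)\<close>.

  To see this, note \<open>u = \<alpha>\<^sub>1 (B - \<alpha> I) y\<close> and compare both norms with \<open>s = \<parallel>X\<^sup>H y\<parallel>\<close>, the sine of the
  angle between \<open>y\<close> and the wanted eigenvector \<open>x\<close>.

  \<^item> The residual of \<open>y\<close> controls \<open>s\<close>: compressing \<open>(B - \<alpha> I) y\<close> with \<open>X\<^sup>H\<close> gives \<open>(L - \<alpha> I) X\<^sup>H y\<close>,
    so \<open>sep(\<alpha>, L) s \<le> \<parallel>(B - \<alpha> I) y\<parallel>\<close> (\<open>sep_mult_orthogonal_component_le_residual\<close>).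

  \<^item> Conversely \<open>s\<close> controls the part of \<open>u\<close> outside \<open>W\<close>: because \<open>y\<close> lies in \<open>W\<close>, the shift in
    \<open>(I - P) (B - \<theta> I) y\<close> is free, and \<open>\<theta> = 1 / (\<lambda> - \<sigma>)\<close> removes the \<open>x\<close>-component of \<open>y\<close>.
    As \<open>\<bar>\<theta>\<bar> \<le> \<parallel>B\<parallel>\<close>, this leaves at most \<open>2 \<parallel>B\<parallel> s\<close> (\<open>projected_image_le_orthogonal_component\<close>).

  SIRA and JD are the choices of \<open>\<alpha>\<^sub>1\<close> for which \<open>- 1 / \<alpha>\<^sub>1\<close> is \<open>1 / (\<nu> - \<sigma>)\<close> and \<open>y\<^sup>H B y\<close>.
\<close>

section \<open>Complex vectors and matrices in the 2-norm\<close>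

lemma mat_mult_vector: "mat c *v v = c *s v"
  for c :: complex and v :: "complex^'n"
  by (simp add: vec_eq_iff matrix_vector_mult_def mat_def if_distrib[of "\<lambda>t. t * _"] cong: if_cong)

lemma norm_scalar_mult: "norm (c *s v) = cmod c * norm v"
  for c :: complex and v :: "complex^'n"
  by (simp add: norm_vec_def norm_mult L2_set_right_distrib)

lemma norm_mult_le_matnorm: "norm (M *v v) \<le> matnorm M * norm v"
  for M :: "complex^'m^'n"
  by (simp add: matnorm_def onorm)

lemma matnorm_nonneg: "0 \<le> matnorm M"
  for M :: "complex^'m^'n"
  by (simp add: matnorm_def onorm_pos_le)

lemma matnorm_pos:
  fixes M :: "complex^'m^'n"
  assumes "M *v v \<noteq> 0"
  shows "0 < matnorm M"
proof -
  have "0 < matnorm M * norm v"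
    using assms norm_mult_le_matnorm[of M v] by (meson less_le_trans zero_less_norm_iff)
  then show ?thesis
    using matnorm_nonneg[of M] by (simp add: zero_less_mult_iff)
qed

lemma cmod_eigenvalue_le_matnorm:
  assumes "eigenpair M \<mu> v"
  shows "cmod \<mu> \<le> matnorm M"
  using assms norm_mult_le_matnorm[of M v] by (simp add: eigenpair_def norm_scalar_mult)

lemma power2_norm_eq_cinner: "complex_of_real ((norm v)\<^sup>2) = cinner v v"
  by (simp add: cinner_def norm_vec_def L2_set_def sum_nonneg mult.commute flip: complex_norm_square)

lemma cinner_mult_right: "cinner v (M *v w) = cinner (ctrans M *v v) w"
proof -
  have "cinner v (M *v w) = (\<Sum>i\<in>UNIV. \<Sum>j\<in>UNIV. cnj (v $ i) * (M $ i $ j * w $ j))"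
    by (simp add: cinner_def matrix_vector_mult_def sum_distrib_left)
  also have "\<dots> = (\<Sum>j\<in>UNIV. \<Sum>i\<in>UNIV. cnj (v $ i) * (M $ i $ j * w $ j))"
    by (rule sum.swap)
  also have "\<dots> = cinner (ctrans M *v v) w"
    by (simp add: cinner_def matrix_vector_mult_def ctrans_def sum_distrib_right sum_distrib_left mult_ac)
  finally show ?thesis .
qed

lemma norm_isometry:
  fixes V :: "complex^'k^'n"
  assumes "ctrans V ** V = mat 1"
  shows "norm (V *v w) = norm w"
proof -
  have "cinner (V *v w) (V *v w) = cinner w w"
    by (simp add: cinner_mult_right matrix_vector_mul_assoc assms)
  then have "(norm (V *v w))\<^sup>2 = (norm w)\<^sup>2"
    by (metis power2_norm_eq_cinner of_real_eq_iff)
  then show ?thesis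
    by simp
qed

text \<open>Pythagoras: the two components are orthogonal because \<open>P\<^sup>H (I - P) = P - P\<^sup>2 = 0\<close>.\<close>

lemma norm_orthogonal_projection:
  fixes P :: "complex^'n^'n"
  assumes idem: "P ** P = P" and sa: "ctrans P = P"
  shows "(norm v)\<^sup>2 = (norm (P *v v))\<^sup>2 + (norm ((mat 1 - P) *v v))\<^sup>2"
proof -
  have "cinner (P *v v) (P *v v) = cinner v (P *v v)"
    by (metis cinner_mult_right idem sa matrix_vector_mul_assoc)
  moreover have "cinner (P *v v) v = cinner v (P *v v)"
    by (simp add: cinner_mult_right sa)
  moreover have "cinner ((mat 1 - P) *v v) ((mat 1 - P) *v v)
      = cinner v v - cinner v (P *v v) - cinner (P *v v) v + cinner (P *v v) (P *v v)"
    by (simp add: matrix_vector_mult_diff_rdistrib cinner_def algebra_simps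
        sum.distrib sum_subtractf)
  ultimately have "cinner v v
      = cinner (P *v v) (P *v v) + cinner ((mat 1 - P) *v v) ((mat 1 - P) *v v)"
    by simp
  then show ?thesis
    by (metis power2_norm_eq_cinner of_real_add of_real_eq_iff)
qed

lemma
  fixes V :: "complex^'k^'n"
  assumes "ctrans V ** V = mat 1"
  shows norm_complement_projection_le: "norm ((mat 1 - V ** ctrans V) *v v) \<le> norm v"
    and norm_ctrans_isometry_le: "norm (ctrans V *v v) \<le> norm v"
proof -
  let ?P = "V ** ctrans V"
  have "?P ** ?P = ?P"
    by (metis assms matrix_mul_assoc matrix_mul_lid)
  moreover have "ctrans ?P = ?P"
    by (simp add: ctrans_mult)
  ultimately have pyth: "(norm v)\<^sup>2 = (norm (?P *v v))\<^sup>2 + (norm ((mat 1 - ?P) *v v))\<^sup>2"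
    by (rule norm_orthogonal_projection)
  then show "norm ((mat 1 - ?P) *v v) \<le> norm v"
    by (simp add: power2_le_imp_le)
  have "norm (ctrans V *v v) = norm (?P *v v)"
    by (simp add: norm_isometry[OF assms] flip: matrix_vector_mul_assoc)
  also have "\<dots> \<le> norm v"
    using pyth by (simp add: power2_le_imp_le)
  finally show "norm (ctrans V *v v) \<le> norm v" .
qed

section \<open>Splitting off one column of a unitary matrix\<close>

lemma sum_UNIV_option: "(\<Sum>k\<in>UNIV. g k) = g None + (\<Sum>k\<in>UNIV. g (Some k))"
  for g :: "'m::finite option \<Rightarrow> 'a::comm_monoid_add"
  by (simp add: UNIV_option_conv sum.reindex)

lemma
  assumes "unitary (cons_column x X)"
  shows unitary_cons_column_isometry: "ctrans X ** X = mat 1"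
    and unitary_cons_column_orthogonal: "ctrans X *v x = 0"
    and unitary_cons_column_decomp: "v = cinner x v *s x + X *v (ctrans X *v v)"
proof -
  let ?Q = "cons_column x X"
  have QQ: "(ctrans ?Q ** ?Q) $ i $ j = mat 1 $ i $ j" for i j
    using assms by (simp add: unitary_def)
  show "ctrans X ** X = mat 1"
  proof (simp only: vec_eq_iff, intro allI)
    fix i j
    show "(ctrans X ** X) $ i $ j = mat 1 $ i $ j"
      using QQ[of "Some i" "Some j"]
      by (simp add: ctrans_def cons_column_def matrix_matrix_mult_def mat_def)
  qed
  show "ctrans X *v x = 0"
  proof (simp only: vec_eq_iff, intro allI)
    fix i
    show "(ctrans X *v x) $ i = 0 $ i"
      using QQ[of "Some i" None]
      by (simp add: ctrans_def cons_column_def matrix_matrix_mult_def matrix_vector_mult_def mat_def)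
  qed
  have "v = ?Q *v (ctrans ?Q *v v)"
    using assms by (simp add: unitary_def matrix_vector_mul_assoc)
  also have "\<dots> = cinner x v *s x + X *v (ctrans X *v v)"
    by (simp add: vec_eq_iff matrix_vector_mult_def ctrans_def cons_column_def cinner_def
        sum_UNIV_option mult.commute)
  finally show "v = cinner x v *s x + X *v (ctrans X *v v)" .
qed

section \<open>Shifted inverses and the separation\<close>

lemma invertible_shift_iff: "invertible (M - mat \<alpha>) \<longleftrightarrow> \<not> eigenvalue M \<alpha>"
  for M :: "complex^'n^'n"
proof -
  have "invertible (M - mat \<alpha>) \<longleftrightarrow> (\<forall>v. (M - mat \<alpha>) *v v = 0 \<longrightarrow> v = 0)"
    by (simp add: invertible_left_inverse matrix_left_invertible_ker)
  then show ?thesis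
    by (auto simp: eigenvalue_def eigenpair_def matrix_vector_mult_diff_rdistrib mat_mult_vector)
qed

lemma matrix_inv_left_mult:
  fixes M :: "complex^'n^'n"
  assumes "invertible M"
  shows "matrix_inv M *v (M *v v) = v"
proof -
  have "M ** matrix_inv M = mat 1 \<and> matrix_inv M ** M = mat 1"
    using assms unfolding invertible_def matrix_inv_def by (rule someI_ex)
  then show ?thesis
    by (simp add: matrix_vector_mul_assoc)
qed

text \<open>A labelling lists the roots of the characteristic polynomial, so \<open>\<sigma>\<close> fails to be an
  eigenvalue as soon as the label closest to it differs from it.\<close>

lemma target_not_eigenvalue:
  fixes A :: "complex^'n^'n"
  assumes lab: "eigenvalue_labelling A lam"
    and first: "0 < cmod (lam 1 - \<sigma>)"
    and second: "cmod (lam 1 - \<sigma>) < cmod (lam 2 - \<sigma>)"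
    and ordered: "\<forall>i\<in>{2..<CARD('n)}. cmod (lam i - \<sigma>) \<le> cmod (lam (Suc i) - \<sigma>)"
  shows "\<not> eigenvalue A \<sigma>"
proof -
  have from_two: "2 \<le> i \<Longrightarrow> i \<le> CARD('n) \<Longrightarrow> 0 < cmod (lam i - \<sigma>)" for i
  proof (induction i rule: dec_induct)
    case base
    then show ?case
      using first second by linarith
  next
    case (step i)
    then show ?case
      using ordered by (force intro: less_le_trans)
  qed
  have "\<sigma> - lam i \<noteq> 0" if "i \<in> {1..CARD('n)}" for i
    using that first from_two[of i] by (cases "i = 1") auto
  then have "det (mat \<sigma> - A) \<noteq> 0"
    using lab by (simp add: eigenvalue_labelling_def)
  then have ker: "(mat \<sigma> - A) *v v = 0 \<Longrightarrow> v = 0" for v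
    by (metis invertible_det_nz invertible_left_inverse matrix_left_invertible_ker)
  show ?thesis
    using ker by (auto simp: eigenvalue_def eigenpair_def matrix_vector_mult_diff_rdistrib mat_mult_vector)
qed

lemma eigenpair_shift_inverse:
  fixes A :: "complex^'n^'n"
  assumes "eigenpair A \<mu> v" "\<not> eigenvalue A \<sigma>"
  shows "eigenpair (matrix_inv (A - mat \<sigma>)) (1 / (\<mu> - \<sigma>)) v"
proof -
  have ne: "\<mu> - \<sigma> \<noteq> 0"
    using assms by (auto simp: eigenvalue_def)
  have inv: "invertible (A - mat \<sigma>)"
    using assms by (simp add: invertible_shift_iff)
  have "(A - mat \<sigma>) *v v = (\<mu> - \<sigma>) *s v"
    using assms(1)
    by (simp add: eigenpair_def matrix_vector_mult_diff_rdistrib mat_mult_vector)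
  then have "v = (\<mu> - \<sigma>) *s (matrix_inv (A - mat \<sigma>) *v v)"
    using matrix_inv_left_mult[OF inv, of v] by (simp only: vector_scalar_commute)
  then have "(1 / (\<mu> - \<sigma>)) *s v = (1 / (\<mu> - \<sigma>)) *s ((\<mu> - \<sigma>) *s (matrix_inv (A - mat \<sigma>) *v v))"
    by simp
  also have "\<dots> = matrix_inv (A - mat \<sigma>) *v v"
    using ne by (simp del: vector_sub_rdistrib add: vector_smult_assoc)
  finally show ?thesis
    using assms(1) by (simp add: eigenpair_def)
qed

lemma
  fixes L :: "complex^'m^'m"
  assumes "\<not> eigenvalue L \<alpha>"
  shows sep_pos: "0 < sep \<alpha> L"
    and sep_lower_bound: "sep \<alpha> L * norm w \<le> norm (L *v w - \<alpha> *s w)"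
proof -
  let ?M = "L - mat \<alpha>"
  have left: "matrix_inv ?M *v (?M *v v) = v" for v
    using assms by (simp add: invertible_shift_iff matrix_inv_left_mult)
  \<comment> \<open>Any nonzero vector shows that the inverse is not the zero matrix, so its norm can be inverted.\<close>
  have "axis undefined 1 \<noteq> (0 :: complex^'m)"
    by (simp add: axis_eq_0_iff)
  then have pos: "0 < matnorm (matrix_inv ?M)"
    using left matnorm_pos by metis
  then show "0 < sep \<alpha> L"
    by (simp add: sep_def)
  have "norm w \<le> matnorm (matrix_inv ?M) * norm (?M *v w)"
    using norm_mult_le_matnorm[of "matrix_inv ?M" "?M *v w"] by (simp add: left)
  then show "sep \<alpha> L * norm w \<le> norm (L *v w - \<alpha> *s w)"
    using pos by (simp add: sep_def matrix_vector_mult_diff_rdistrib mat_mult_vector field_simps)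
qed

section \<open>The two bounds on the component orthogonal to the eigenvector\<close>

text \<open>Since \<open>x\<close> is an eigenvector of \<open>B\<close>, compressing with \<open>X\<^sup>H\<close> kills its contribution:
  \<open>X\<^sup>H (B - \<alpha> I) y = (L - \<alpha> I) X\<^sup>H y\<close>. So a small residual of \<open>y\<close> forces \<open>y\<close> close to the
  direction of \<open>x\<close>.\<close>

lemma sep_mult_orthogonal_component_le_residual:
  fixes B :: "complex^'n^'n" and X :: "complex^'m^'n"
  assumes eig: "eigenpair B \<theta> x"
    and unit: "unitary (cons_column x X)"
    and nev: "\<not> eigenvalue (ctrans X ** B ** X) \<alpha>"
  shows "sep \<alpha> (ctrans X ** B ** X) * norm (ctrans X *v y) \<le> norm (B *v y - \<alpha> *s y)"
proof -
  let ?L = "ctrans X ** B ** X" and ?w = "ctrans X *v y"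
  have "ctrans X *v (B *v y) = ctrans X *v (B *v (cinner x y *s x + X *v ?w))"
    using unitary_cons_column_decomp[OF unit, of y] by simp
  also have "\<dots> = (cinner x y * \<theta>) *s (ctrans X *v x) + ?L *v ?w"
    using eig by (simp add: eigenpair_def matrix_vector_right_distrib vector_scalar_commute
        matrix_vector_mul_assoc matrix_mul_assoc)
  also have "\<dots> = ?L *v ?w"
    by (simp add: unitary_cons_column_orthogonal[OF unit])
  finally have compress: "ctrans X *v (B *v y - \<alpha> *s y) = ?L *v ?w - \<alpha> *s ?w"
    by (simp add: matrix_vector_mult_diff_distrib vector_scalar_commute)
  have "sep \<alpha> ?L * norm ?w \<le> norm (?L *v ?w - \<alpha> *s ?w)"
    by (rule sep_lower_bound[OF nev])
  also have "\<dots> \<le> norm (B *v y - \<alpha> *s y)"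
    unfolding compress[symmetric]
    by (rule norm_ctrans_isometry_le[OF unitary_cons_column_isometry[OF unit]])
  finally show ?thesis .
qed

text \<open>The projection \<open>Q\<close> annihilates \<open>y\<close>, so \<open>B y\<close> may be replaced by \<open>(B - \<theta> I) y\<close>, and
  \<open>B - \<theta> I\<close> annihilates \<open>x\<close>. What remains is \<open>B - \<theta> I\<close>, of norm at most \<open>2 \<parallel>B\<parallel>\<close>, acting on the
  component of \<open>y\<close> orthogonal to \<open>x\<close>.\<close>

lemma projected_image_le_orthogonal_component:
  fixes B Q :: "complex^'n^'n" and X :: "complex^'m^'n"
  assumes eig: "eigenpair B \<theta> x"
    and unit: "unitary (cons_column x X)"
    and Qy: "Q *v y = 0"
    and contr: "\<And>v. norm (Q *v v) \<le> norm v"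
  shows "norm (Q *v (B *v y)) \<le> 2 * matnorm B * norm (ctrans X *v y)"
proof -
  define g where "g = X *v (ctrans X *v y)"
  have y: "y = cinner x y *s x + g"
    unfolding g_def by (rule unitary_cons_column_decomp[OF unit])
  have norm_g: "norm g = norm (ctrans X *v y)"
    unfolding g_def by (rule norm_isometry[OF unitary_cons_column_isometry[OF unit]])
  have "B *v y - \<theta> *s y
      = B *v (cinner x y *s x + g) - \<theta> *s (cinner x y *s x + g)"
    using y by simp
  also have "\<dots> = B *v g - \<theta> *s g"
    using eig by (simp add: eigenpair_def matrix_vector_right_distrib vector_scalar_commute mult.commute)
  finally have shift: "B *v y - \<theta> *s y = B *v g - \<theta> *s g" .
  have "Q *v (B *v y) = Q *v (B *v y - \<theta> *s y)"
    by (simp add: matrix_vector_mult_diff_distrib vector_scalar_commute Qy)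
  then have "norm (Q *v (B *v y)) \<le> norm (B *v g - \<theta> *s g)"
    using contr[of "B *v y - \<theta> *s y"] by (simp only: shift)
  also have "\<dots> \<le> norm (B *v g) + norm (\<theta> *s g)"
    by (rule norm_triangle_ineq4)
  also have "\<dots> \<le> matnorm B * norm g + matnorm B * norm g"
    by (simp only: norm_scalar_mult)
      (intro add_mono norm_mult_le_matnorm mult_right_mono cmod_eigenvalue_le_matnorm[OF eig] norm_ge_zero)
  finally show ?thesis
    by (simp add: norm_g)
qed

section \<open>From the inner error to the error outside the subspace\<close>

text \<open>Projecting \<open>ut - u = \<epsilon> \<parallel>u\<parallel> f\<close> rescales the error by \<open>sin \<angle>(W, f)\<close>.\<close>

lemma proj_rel_error_eq:
  fixes u ut f :: "complex^'n"
  assumes "ut = u + (rel_error u ut * norm u) *\<^sub>R f" "norm f = 1"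
  shows "proj_rel_error W u ut =
    rel_error u ut * norm u * sin_angle W f / norm ((mat 1 - orth_projector W) *v u)"
proof -
  let ?Q = "mat 1 - orth_projector W"
  have "?Q *v ut = ?Q *v u + (rel_error u ut * norm u) *\<^sub>R (?Q *v f)"
    by (subst assms(1))
      (simp add: matrix_vector_right_distrib linear_scale[OF matrix_vector_mul_linear])
  moreover have "0 \<le> rel_error u ut"
    by (simp add: rel_error_def)
  ultimately show ?thesis
    using assms(2) by (simp add: proj_rel_error_def sin_angle_def Let_def abs_mult)
qed

lemma sin_angle_pos:
  assumes "orthonormal_basis_cols V W" "f \<notin> W"
  shows "0 < sin_angle W f"
proof -
  have W: "W = range ((*v) V)"
    using assms(1) by (auto simp: orthonormal_basis_cols_def range_matrix_vector_mult)
  have "f \<noteq> V *v (ctrans V *v f)"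
    using W assms(2) by blast
  then have "(mat 1 - V ** ctrans V) *v f \<noteq> 0"
    by (simp add: matrix_vector_mult_diff_rdistrib flip: matrix_vector_mul_assoc)
  moreover have "f \<noteq> 0"
    using W assms(2) by (metis matrix_vector_mult_0_right rangeI)
  ultimately show ?thesis
    by (simp add: sin_angle_def orth_projector_eq[OF assms(1)])
qed

text \<open>With \<open>\<alpha> = - \<alpha>\<^sub>2 / \<alpha>\<^sub>1\<close> the exact solution is \<open>u = \<alpha>\<^sub>1 (B - \<alpha> I) y\<close>, while its part outside \<open>W\<close> is
  just \<open>\<alpha>\<^sub>1\<close> times that of \<open>B y\<close>. The factor \<open>\<bar>\<alpha>\<^sub>1\<bar>\<close> cancels in the quotient, and the two
  bounds above combine through their common quantity \<open>\<parallel>X\<^sup>H y\<parallel>\<close>.\<close>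

lemma inner_solve_rel_error_le:
  fixes A :: "complex^'n^'n" and X :: "complex^'m^'n" and V :: "complex^'k^'n"
  assumes nev\<sigma>: "\<not> eigenvalue A \<sigma>"
    and eig: "eigenpair A \<mu> x"
    and B: "B = matrix_inv (A - mat \<sigma>)"
    and unit: "unitary (cons_column x X)"
    and L: "L = ctrans X ** B ** X"
    and basis: "orthonormal_basis_cols V W"
    and y: "y \<in> W"
    and \<alpha>1: "\<alpha>\<^sub>1 \<noteq> 0" and \<alpha>: "\<alpha> = - \<alpha>\<^sub>2 / \<alpha>\<^sub>1"
    and nev: "\<not> eigenvalue L \<alpha>"
    and solve: "inner_solve A \<sigma> W y \<alpha>\<^sub>1 \<alpha>\<^sub>2 u ut f"
  shows "rel_error u ut \<le> 2 * matnorm B / (sep \<alpha> L * sin_angle W f) * proj_rel_error W u ut"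
proof -
  define Q where "Q = mat 1 - orth_projector W"
  have QV: "Q = mat 1 - V ** ctrans V"
    by (simp add: Q_def orth_projector_eq[OF basis])
  have VV: "ctrans V ** V = mat 1"
    using basis by (simp add: orthonormal_basis_cols_def)
  have contr: "norm (Q *v v) \<le> norm v" for v
    unfolding QV by (rule norm_complement_projection_le[OF VV])
  have Qy: "Q *v y = 0"
  proof -
    obtain c where "y = V *v c"
      using y basis by (auto simp: orthonormal_basis_cols_def simp flip: range_matrix_vector_mult)
    then have "(V ** ctrans V) *v y = y"
      by (metis VV matrix_mul_assoc matrix_mul_rid matrix_vector_mul_assoc)
    then show ?thesis
      by (simp add: QV matrix_vector_mult_diff_rdistrib)
  qed
  have eigB: "eigenpair B (1 / (\<mu> - \<sigma>)) x"
    unfolding B by (rule eigenpair_shift_inverse[OF eig nev\<sigma>])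
  have cancel: "B *v ((A - mat \<sigma>) *v v) = v" for v
    unfolding B using nev\<sigma> by (simp add: invertible_shift_iff matrix_inv_left_mult)
  have u0: "u \<noteq> 0" and Qu0: "Q *v u \<noteq> 0"
    and ut: "ut = u + (rel_error u ut * norm u) *\<^sub>R f" and f1: "norm f = 1" and fW: "f \<notin> W"
    using solve by (auto simp: inner_solve_def Q_def)
  have "u = B *v (\<alpha>\<^sub>1 *s y + \<alpha>\<^sub>2 *s ((A - mat \<sigma>) *v y))"
    using solve cancel[of u] by (simp add: inner_solve_def)
  then have u: "u = \<alpha>\<^sub>1 *s (B *v y) + \<alpha>\<^sub>2 *s y"
    by (simp add: matrix_vector_right_distrib vector_scalar_commute cancel)
  also have "\<dots> = \<alpha>\<^sub>1 *s (B *v y - \<alpha> *s y)"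
    using \<alpha>1 by (simp add: \<alpha>)
  finally have norm_u: "norm u = cmod \<alpha>\<^sub>1 * norm (B *v y - \<alpha> *s y)"
    by (simp only: norm_scalar_mult)
  have norm_Qu: "norm (Q *v u) = cmod \<alpha>\<^sub>1 * norm (Q *v (B *v y))"
    by (simp add: u matrix_vector_right_distrib vector_scalar_commute Qy norm_scalar_mult)
  have sep0: "0 < sep \<alpha> L"
    by (rule sep_pos[OF nev])
  have "sep \<alpha> L * norm (Q *v u)
      \<le> cmod \<alpha>\<^sub>1 * (sep \<alpha> L * (2 * matnorm B * norm (ctrans X *v y)))"
    using projected_image_le_orthogonal_component[OF eigB unit Qy contr] sep0
    by (simp add: norm_Qu mult.left_commute mult_left_mono)
  also have "\<dots> = 2 * matnorm B * cmod \<alpha>\<^sub>1 * (sep \<alpha> L * norm (ctrans X *v y))"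
    by simp
  also have "\<dots> \<le> 2 * matnorm B * cmod \<alpha>\<^sub>1 * norm (B *v y - \<alpha> *s y)"
    using sep_mult_orthogonal_component_le_residual[OF eigB unit, of \<alpha> y] nev
    by (intro mult_left_mono) (simp_all add: L matnorm_nonneg)
  finally have key: "sep \<alpha> L * norm (Q *v u) \<le> 2 * matnorm B * norm u"
    by (simp add: norm_u)
  have "0 \<le> rel_error u ut"
    by (simp add: rel_error_def)
  then have "rel_error u ut * (sep \<alpha> L * norm (Q *v u)) \<le> rel_error u ut * (2 * matnorm B * norm u)"
    using key by (rule mult_left_mono[rotated])
  then have "rel_error u ut \<le> rel_error u ut * (2 * matnorm B * norm u) / (sep \<alpha> L * norm (Q *v u))"
    using sep0 Qu0 by (simp add: pos_le_divide_eq)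
  also have "\<dots> = 2 * matnorm B / (sep \<alpha> L * sin_angle W f) * proj_rel_error W u ut"
    using sin_angle_pos[OF basis fW] by (simp add: proj_rel_error_eq[OF ut f1] Q_def)
  finally show ?thesis .
qed

section \<open>The error bounds for the general, SIRA and JD systems\<close>

theorem theorem3:
  fixes A B :: "complex^'n^'n"
    and \<sigma> \<nu> :: complex
    and lam :: "nat \<Rightarrow> complex"
    and x y :: "complex^'n"
    and X :: "complex^'m^'n"
    and L :: "complex^'m^'m"
    and W :: "(complex^'n) set"
    and V :: "complex^'k^'n"
    and z :: "complex^'k"
  assumes "eigenvalue_labelling A lam"
    and "0 < cmod (lam 1 - \<sigma>)"
    and "cmod (lam 1 - \<sigma>) < cmod (lam 2 - \<sigma>)"
    and "\<forall>i\<in>{2..<CARD('n)}. cmod (lam i - \<sigma>) \<le> cmod (lam (Suc i) - \<sigma>)"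
    and "eigenpair A (lam 1) x" and "norm x = 1"
    and "B = matrix_inv (A - mat \<sigma>)"
    and "unitary (cons_column x X)"
    and "L = ctrans X ** B ** X"
    and "orthonormal_basis_cols V W"
    and "eigenpair (ctrans V ** A ** V) \<nu> z" and "norm z = 1"
    and "y = V *v z"
  shows
    "(\<forall>\<alpha>\<^sub>1 \<alpha>\<^sub>2 \<alpha> u ut f.
        \<alpha>\<^sub>1 \<noteq> 0 \<longrightarrow> \<alpha> = - \<alpha>\<^sub>2 / \<alpha>\<^sub>1 \<longrightarrow> \<not> eigenvalue L \<alpha> \<longrightarrow>
        inner_solve A \<sigma> W y \<alpha>\<^sub>1 \<alpha>\<^sub>2 u ut f \<longrightarrow>
        rel_error u ut \<le>
          2 * matnorm B / (sep \<alpha> L * sin_angle W f) * proj_rel_error W u ut) \<and>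
     (\<forall>u\<^sub>S ut\<^sub>S f\<^sub>S.
        \<nu> \<noteq> \<sigma> \<longrightarrow> \<not> eigenvalue L (1 / (\<nu> - \<sigma>)) \<longrightarrow>
        inner_solve A \<sigma> W y (\<sigma> - \<nu>) 1 u\<^sub>S ut\<^sub>S f\<^sub>S \<longrightarrow>
        rel_error u\<^sub>S ut\<^sub>S \<le>
          2 * matnorm B / (sep (1 / (\<nu> - \<sigma>)) L * sin_angle W f\<^sub>S) * proj_rel_error W u\<^sub>S ut\<^sub>S) \<and>
     (\<forall>u\<^sub>J ut\<^sub>J f\<^sub>J.
        cinner y (B *v y) \<noteq> 0 \<longrightarrow> \<not> eigenvalue L (cinner y (B *v y)) \<longrightarrow>
        inner_solve A \<sigma> W y (- 1 / cinner y (B *v y)) 1 u\<^sub>J ut\<^sub>J f\<^sub>J \<longrightarrow>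
        rel_error u\<^sub>J ut\<^sub>J \<le>
          2 * matnorm B / (sep (cinner y (B *v y)) L * sin_angle W f\<^sub>J) * proj_rel_error W u\<^sub>J ut\<^sub>J)"
proof -
  note nev\<sigma> = target_not_eigenvalue[OF assms(1-4)]
  have "y \<in> W"
    using assms(10) unfolding assms(13)
    by (auto simp: orthonormal_basis_cols_def simp flip: range_matrix_vector_mult)
  note bound = inner_solve_rel_error_le[OF nev\<sigma> assms(5,7-10) this]
  have "1 / (\<nu> - \<sigma>) = - 1 / (\<sigma> - \<nu>)"
    by (metis minus_diff_eq minus_divide_divide)
  moreover have "cinner y (B *v y) = - 1 / (- 1 / cinner y (B *v y))"
    by simp
  ultimately show ?thesis
    by (intro conjI allI impI) (rule bound; simp)+
qed

end
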